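(* Let $\Lambda=\{\lambda_j\}_{j\ge1}$ and $\Gamma=\{\gamma_j\}_{j\ge1}$ be Waterman sequences and let $1\le p\le q<\infty$. Then the embedding $\Lambda\mathrm{BV}^{(p)}\subseteq\Gamma\mathrm{BV}^{(q)}$ holds if and only if $$\sup_{1\le n<\infty}\frac{\Gamma(n)^{\frac1q}}{\Lambda(n)^{\frac1p}}<\infty .$$
   Context: A Waterman sequence is a nondecreasing sequence $\Lambda=\{\lambda_j\}_{j=1}^\infty$ of positive numbers with $\sum_{j=1}^\infty 1/\lambda_j=\infty$. For integers $n\ge1$, $\Lambda(n):=\sum_{j=1}^{n}1/\lambda_j$ and $\Gamma(n):=\sum_{j=1}^{n}1/\gamma_j$. All functions are real-valued on $[0,1]$. For an interval $I\subseteq[0,1]$, $f(I):=f(\sup I)-f(\inf I)$. For $1\le p<\infty$ and a Waterman sequence $\Lambda$, $\Lambda\mathrm{BV}^{(p)}$ (the Waterman-Shiba class) is the set of all $f$ such that $\sup\sum_{j=1}^s |f(I_j)|^p/\lambda_j<\infty$, the supremum being over all finite (ordered) collections $\{I_j\}_{j=1}^s$ of nonoverlapping subintervals of $[0,1]$; $\Gamma\mathrm{BV}^{(q)}$ is defined in the same way with $\gamma_j$ and $q$ in place of $\lambda_j$ and $p$. *)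

theory Defs
  imports "HOL-Analysis.Analysis"
begin

text \<open>
  Sequences are functions on \<^typ>\<open>nat\<close> indexed from 1; the value at 0 is never used.
  A real function on $[0,1]$ is a function \<^typ>\<open>real \<Rightarrow> real\<close> of which only the values
  on \<^term>\<open>{0..1::real}\<close> are used.
\<close>

definition Waterman_sequence :: "(nat \<Rightarrow> real) \<Rightarrow> bool" where
  "Waterman_sequence L \<longleftrightarrow>
     mono_on {1..} L \<and> (\<forall>j\<ge>1. 0 < L j) \<and>
     filterlim (\<lambda>n. \<Sum>j=1..n. 1 / L j) at_top sequentially"

definition recip_sum :: "(nat \<Rightarrow> real) \<Rightarrow> nat \<Rightarrow> real" where
  "recip_sum L n = (\<Sum>j=1..n. 1 / L j)"

definition increment :: "(real \<Rightarrow> real) \<Rightarrow> real set \<Rightarrow> real" where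
  "increment f I = f (Sup I) - f (Inf I)"

text \<open>
  Intervals may be open, closed or half-open, and may degenerate to a point (which contributes
  increment 0). Nonoverlapping means that the interiors are pairwise disjoint, so
  neighbouring intervals may share an endpoint. The order of the family is arbitrary: it need not
  follow the order of the line.
\<close>

definition nonoverlapping_intervals :: "nat \<Rightarrow> (nat \<Rightarrow> real set) \<Rightarrow> bool" where
  "nonoverlapping_intervals s I \<longleftrightarrow>
     (\<forall>j\<in>{1..s}. is_interval (I j) \<and> I j \<noteq> {} \<and> I j \<subseteq> {0..1}) \<and>
     (\<forall>i\<in>{1..s}. \<forall>j\<in>{1..s}. i \<noteq> j \<longrightarrow> interior (I i) \<inter> interior (I j) = {})"

definition Waterman_Shiba :: "(nat \<Rightarrow> real) \<Rightarrow> real \<Rightarrow> (real \<Rightarrow> real) set" where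
  "Waterman_Shiba L p =
     {f. bdd_above {(\<Sum>j=1..s. \<bar>increment f (I j)\<bar> powr p / L j) | s I.
                      nonoverlapping_intervals s I}}"

end

theory Submission
  imports Defs
begin

text \<open>
  Write \<open>a\<^sub>j = \<bar>f(I\<^sub>j)\<bar>\<close> for the increments of \<open>f\<close> over a nonoverlapping family.

  If the quotients are bounded by \<open>C\<close>, then the inclusion comes from an inequality between weighted
  sums. A permutation of a nonoverlapping family is again nonoverlapping, and the largest
  \<open>\<Gamma>\<close>-sum occurs when the \<open>a\<^sub>j\<close> decrease, so it suffices to treat decreasing \<open>a\<^sub>j\<close>. With
  \<open>b\<^sub>j = a\<^sub>j\<^sup>p\<close> and \<open>r = q/p\<close>, summation by parts turns \<open>\<Gamma>(n) \<le> C\<^sup>q \<Lambda>(n)\<^sup>r\<close> into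
  \<open>\<Sum> b\<^sub>j\<^sup>r/\<gamma>\<^sub>j \<le> C\<^sup>q \<Sum> b\<^sub>j\<^sup>r (\<Lambda>(j)\<^sup>r - \<Lambda>(j-1)\<^sup>r)\<close>. The last sum is at most \<open>(\<Sum> b\<^sub>j/\<lambda>\<^sub>j)\<^sup>r\<close>;
  this is the classical fact that the Lorentz norm of \<open>L(p,q)\<close> is dominated by that of \<open>L(p,p)\<close>
  for \<open>p \<le> q\<close>, and it rests on the convexity of \<open>x \<mapsto> x\<^sup>r\<close>
  (lemma \<open>sum_powr_increments_le_powr_sum\<close>).

  If the quotients are unbounded, choose \<open>n\<^sub>k\<close> whose quotient exceeds \<open>4\<^sup>k\<close>, and let \<open>f\<close> vanish
  except at countably many points, \<open>n\<^sub>k\<close> of which carry the value \<open>h\<^sub>k\<close> given by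
  \<open>h\<^sub>k\<^sup>p \<Lambda>(n\<^sub>k) = 2\<^sup>-\<^sup>k\<close>. An increment of \<open>f\<close> is controlled by the values at the two endpoints,
  and distinct nondegenerate members of a nonoverlapping family have distinct right (and distinct
  left) endpoints. Hence the points of height \<open>h\<^sub>k\<close> contribute at most
  \<open>2 h\<^sub>k\<^sup>p \<Lambda>(n\<^sub>k) = 2 \<cdot> 2\<^sup>-\<^sup>k\<close> to a \<open>\<Lambda>\<close>-sum
  (lemma \<open>mem_Waterman_Shiba_if_countable_support\<close>). This is summable over \<open>k\<close>, so
  \<open>f\<close> lies in the class of \<open>\<Lambda>\<close>. But \<open>n\<^sub>k\<close> short intervals ending at these points
  give the \<open>\<Gamma>\<close>-sum \<open>h\<^sub>k\<^sup>q \<Gamma>(n\<^sub>k) \<ge> 2\<^sup>k\<close>.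
\<close>

section \<open>Sums of decreasing sequences\<close>

text \<open>
  \<open>A\<close> has at most as many elements beyond \<open>n\<close> as it misses below, and the value \<open>b n\<close> separates the
  terms of the two kinds.
\<close>

lemma sum_le_sum_initial_segment:
  fixes b :: "nat \<Rightarrow> real"
  assumes anti: "antimono_on S b" and A: "A \<subseteq> S" "A \<subseteq> {1..}" "finite A" "card A \<le> n"
    and n: "{1..n} \<subseteq> S" and nonneg: "\<And>i. i \<in> {1..n} \<Longrightarrow> 0 \<le> b i"
  shows "sum b A \<le> sum b {1..n}"
proof (cases "n = 0")
  case True
  then show ?thesis using A by auto
next
  case False
  let ?N = "{1..n}"
  have "card (A - ?N) \<le> card (?N - A)"
    using A by (intro card_le_sym_Diff) auto
  have "sum b (A - ?N) \<le> real (card (A - ?N)) * b n"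
    using anti A n False by (intro sum_bounded_above) (auto elim!: monotone_onD)
  also have "\<dots> \<le> real (card (?N - A)) * b n"
    using \<open>card (A - ?N) \<le> card (?N - A)\<close> nonneg[of n] False by (intro mult_right_mono) auto
  also have "\<dots> \<le> sum b (?N - A)"
    using anti n False by (intro sum_bounded_below) (auto elim!: monotone_onD)
  finally have "sum b (A - ?N) \<le> sum b (?N - A)" .
  moreover have "sum b A = sum b (A - ?N) + sum b (A \<inter> ?N)"
    using A by (subst sum.union_disjoint[symmetric]) (auto intro: sum.cong)
  moreover have "sum b ?N = sum b (?N - A) + sum b (A \<inter> ?N)"
    by (subst sum.union_disjoint[symmetric]) (auto intro: sum.cong)
  ultimately show ?thesis by linarith
qed

text \<open>
  Summation by parts: decreasing nonnegative weights preserve the domination of partial sums.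
\<close>

lemma sum_mult_antimono_le:
  fixes c u v :: "nat \<Rightarrow> real"
  assumes anti: "antimono_on {1..s} c" and nonneg: "\<And>j. j \<in> {1..s} \<Longrightarrow> 0 \<le> c j"
    and le: "\<And>n. n \<le> s \<Longrightarrow> sum u {1..n} \<le> sum v {1..n}"
  shows "(\<Sum>j=1..s. c j * u j) \<le> (\<Sum>j=1..s. c j * v j)"
proof -
  define D where "D n = (\<Sum>j=1..n. v j - u j)" for n
  have D: "0 \<le> D n" if "n \<le> s" for n
    using le[OF that] by (simp add: D_def sum_subtractf)
  have "c (Suc n) * D (Suc n) \<le> (\<Sum>j=1..Suc n. c j * (v j - u j))" if "Suc n \<le> s" for n
    using that
  proof (induction n)
    case 0
    then show ?case by (simp add: D_def)
  next
    case (Suc n)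
    have "c (Suc (Suc n)) * D (Suc n) \<le> c (Suc n) * D (Suc n)"
      using anti Suc.prems D by (intro mult_right_mono) (auto elim!: monotone_onD)
    with Suc show ?case by (simp add: D_def algebra_simps)
  qed
  note * = this
  have "0 \<le> (\<Sum>j=1..s. c j * (v j - u j))"
  proof (cases s)
    case (Suc n)
    then show ?thesis using *[of n] D[of s] nonneg[of s]
      by (metis (no_types, lifting) atLeastAtMost_iff le_add1 mult_nonneg_nonneg order.refl
          order.trans plus_1_eq_Suc)
  qed simp
  then show ?thesis by (simp add: right_diff_distrib sum_subtractf)
qed

lemma exists_decreasing_enumeration:
  fixes a :: "nat \<Rightarrow> real"
  shows "\<exists>\<pi>. bij_betw \<pi> {1..s} {1..s} \<and> antimono_on {1..s} (a \<circ> \<pi>)"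
proof -
  define xs where "xs = sort_key (\<lambda>j. - a j) [1..<Suc s]"
  have len: "length xs = s" and set: "set xs = {1..s}" and dist: "distinct xs"
    by (auto simp: xs_def)
  have sorted: "sorted (map (\<lambda>j. - a j) xs)"
    by (simp add: xs_def)
  have "bij_betw ((!) xs \<circ> (\<lambda>j. j - 1)) {1..s} {1..s}"
  proof (rule bij_betw_trans)
    show "bij_betw (\<lambda>j. j - 1) {1..s} {..<s}"
      by (rule bij_betw_byWitness[where f' = Suc]) auto
    show "bij_betw ((!) xs) {..<s} {1..s}"
      using bij_betw_nth[OF dist] len set by auto
  qed
  moreover have "antimono_on {1..s} (a \<circ> ((!) xs \<circ> (\<lambda>j. j - 1)))"
  proof (rule monotone_onI)
    fix i j assume "i \<in> {1..s}" "j \<in> {1..s}" "i \<le> j"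
    then show "(a \<circ> ((!) xs \<circ> (\<lambda>j. j - 1))) j \<le> (a \<circ> ((!) xs \<circ> (\<lambda>j. j - 1))) i"
      using sorted_nth_mono[OF sorted, of "i - 1" "j - 1"] len by auto
  qed
  ultimately show ?thesis by blast
qed

text \<open>
  The rearrangement inequality, reduced by summation by parts to partial sums: there it says that
  any \<open>n\<close> terms of a decreasing sequence have at most the sum of the first \<open>n\<close>.
\<close>

lemma sum_mult_le_sum_mult_decreasing_rearrangement:
  fixes a w :: "nat \<Rightarrow> real"
  assumes w: "antimono_on {1..s} w" "\<And>j. j \<in> {1..s} \<Longrightarrow> 0 \<le> w j"
    and a: "\<And>j. j \<in> {1..s} \<Longrightarrow> 0 \<le> a j"
    and bij: "bij_betw \<pi> {1..s} {1..s}" and anti: "antimono_on {1..s} (a \<circ> \<pi>)"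
  shows "(\<Sum>j=1..s. w j * a j) \<le> (\<Sum>j=1..s. w j * a (\<pi> j))"
proof (rule sum_mult_antimono_le[OF w])
  fix n assume n: "n \<le> s"
  define A where "A = {i \<in> {1..s}. \<pi> i \<in> {1..n}}"
  have bijA: "bij_betw \<pi> A {1..n}"
  proof (rule bij_betw_imageI)
    show "inj_on \<pi> A"
      using bij unfolding A_def bij_betw_def by (blast intro: inj_on_subset)
    have "\<pi> ` A = \<pi> ` {1..s} \<inter> {1..n}" unfolding A_def by blast
    then show "\<pi> ` A = {1..n}" using bij n by (auto simp: bij_betw_def)
  qed
  have "sum a {1..n} = sum (a \<circ> \<pi>) A"
    using sum.reindex_bij_betw[OF bijA, of a] by simp
  also have "\<dots> \<le> sum (a \<circ> \<pi>) {1..n}"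
  proof (rule sum_le_sum_initial_segment[OF anti])
    show "card A \<le> n" using bij_betw_same_card[OF bijA] by simp
    show "0 \<le> (a \<circ> \<pi>) i" if "i \<in> {1..n}" for i
      using a[of "\<pi> i"] bij_betwE[OF bij] n that by auto
  qed (use n in \<open>auto simp: A_def\<close>)
  finally show "sum a {1..n} \<le> (\<Sum>j=1..n. a (\<pi> j))" by simp
qed auto

section \<open>Weighted sums of powers\<close>

text \<open>
  Convexity of \<open>x \<mapsto> x\<^sup>r\<close> in difference form. The end \<open>x = 0\<close>, where the power need not have a
  derivative, is covered by continuity.
\<close>

lemma powr_increment_mono:
  fixes x y d r :: real
  assumes "0 \<le> x" "x \<le> y" "0 \<le> d" "1 \<le> r"
  shows "(x + d) powr r - x powr r \<le> (y + d) powr r - y powr r"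
proof (rule DERIV_nonneg_imp_increasing_open[OF \<open>x \<le> y\<close>])
  fix t assume t: "x < t" "t < y"
  have "((\<lambda>t. (t + d) powr r - t powr r) has_real_derivative
      r * (t + d) powr (r - 1) - r * t powr (r - 1)) (at t)"
    using t assms by (auto intro!: derivative_eq_intros)
  moreover have "0 \<le> r * (t + d) powr (r - 1) - r * t powr (r - 1)"
    using t assms by (auto intro!: mult_left_mono powr_mono2)
  ultimately show "\<exists>y. ((\<lambda>t. (t + d) powr r - t powr r) has_real_derivative y) (at t) \<and> 0 \<le> y"
    by blast
next
  show "continuous_on {x..y} (\<lambda>t. (t + d) powr r - t powr r)"
    using assms by (intro continuous_on_diff continuous_on_powr' continuous_on_add continuous_on_id
        continuous_on_const) auto
qed

text \<open>
  In the inductive step the partial sum \<open>T\<close> of \<open>\<Sum> b\<^sub>j l\<^sub>j\<close> is at least \<open>b\<^sub>n\<^sub>+\<^sub>1 L(n)\<close>, where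
  \<open>L(n) = l\<^sub>1 + \<dots> + l\<^sub>n\<close>, because \<open>b\<close> decreases. Adding \<open>b\<^sub>n\<^sub>+\<^sub>1 l\<^sub>n\<^sub>+\<^sub>1\<close> therefore raises \<open>T\<^sup>r\<close> at least as much as it raises
  the \<open>r\<close>-th power of the smaller number \<open>b\<^sub>n\<^sub>+\<^sub>1 L(n)\<close>.
\<close>

lemma sum_powr_increments_le_powr_sum:
  fixes b l :: "nat \<Rightarrow> real"
  assumes anti: "antimono_on {1..s} b" and b: "\<And>j. j \<in> {1..s} \<Longrightarrow> 0 \<le> b j"
    and l: "\<And>j. j \<in> {1..s} \<Longrightarrow> 0 \<le> l j" and r: "1 \<le> r"
  shows "(\<Sum>j=1..s. b j powr r * (sum l {1..j} powr r - sum l {1..j-1} powr r))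
      \<le> (\<Sum>j=1..s. b j * l j) powr r"
proof -
  have "(\<Sum>j=1..n. b j powr r * (sum l {1..j} powr r - sum l {1..j-1} powr r))
      \<le> (\<Sum>j=1..n. b j * l j) powr r" if "n \<le> s" for n
    using that
  proof (induction n)
    case 0
    then show ?case by simp
  next
    case (Suc n)
    let ?L = "sum l {1..n}" and ?T = "\<Sum>j=1..n. b j * l j" and ?b = "b (Suc n)" and ?l = "l (Suc n)"
    have "?b * ?L \<le> ?T"
      unfolding sum_distrib_left using anti Suc.prems l
      by (intro sum_mono mult_right_mono) (auto elim!: monotone_onD)
    have L: "0 \<le> ?L" using l Suc.prems by (intro sum_nonneg) auto
    have nn: "0 \<le> ?b" "0 \<le> ?l" using b l Suc.prems by auto
    have "?b powr r * ((?L + ?l) powr r - ?L powr r)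
        = (?b * (?L + ?l)) powr r - (?b * ?L) powr r"
      using L nn by (simp add: powr_mult right_diff_distrib)
    also have "\<dots> = (?b * ?L + ?b * ?l) powr r - (?b * ?L) powr r"
      by (simp add: distrib_left)
    also have "\<dots> \<le> (?T + ?b * ?l) powr r - ?T powr r"
      using L nn r \<open>?b * ?L \<le> ?T\<close> by (intro powr_increment_mono) auto
    finally show ?case using Suc.IH Suc.prems by simp
  qed
  then show ?thesis by blast
qed

text \<open>
  The right side of the hypothesis is itself a partial sum, with the increments
  \<open>K (L(j)\<^sup>r - L(j-1)\<^sup>r)\<close> as terms, so summation by parts replaces \<open>g\<close> by these increments.
\<close>

lemma sum_powr_weighted_le:
  fixes b g l :: "nat \<Rightarrow> real"
  assumes anti: "antimono_on {1..s} b" and b: "\<And>j. j \<in> {1..s} \<Longrightarrow> 0 \<le> b j"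
    and l: "\<And>j. j \<in> {1..s} \<Longrightarrow> 0 \<le> l j" and r: "1 \<le> r" and K: "0 \<le> K"
    and le: "\<And>n. n \<in> {1..s} \<Longrightarrow> sum g {1..n} \<le> K * sum l {1..n} powr r"
  shows "(\<Sum>j=1..s. b j powr r * g j) \<le> K * (\<Sum>j=1..s. b j * l j) powr r"
proof -
  define v where "v j = K * (sum l {1..j} powr r - sum l {1..j-1} powr r)" for j
  have tel: "sum v {1..n} = K * sum l {1..n} powr r" for n
    by (induction n) (auto simp: v_def algebra_simps)
  have "(\<Sum>j=1..s. b j powr r * g j) \<le> (\<Sum>j=1..s. b j powr r * v j)"
  proof (rule sum_mult_antimono_le)
    show "antimono_on {1..s} (\<lambda>j. b j powr r)"
      using anti b r by (auto intro!: monotone_onI powr_mono2 elim!: monotone_onD)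
    show "sum g {1..n} \<le> sum v {1..n}" if "n \<le> s" for n
    proof (cases "n = 0")
      case False
      then show ?thesis unfolding tel using that by (intro le) auto
    qed simp
  qed auto
  also have "\<dots> = K * (\<Sum>j=1..s. b j powr r * (sum l {1..j} powr r - sum l {1..j-1} powr r))"
    by (simp add: v_def sum_distrib_left mult_ac)
  also have "\<dots> \<le> K * (\<Sum>j=1..s. b j * l j) powr r"
    by (intro mult_left_mono sum_powr_increments_le_powr_sum anti b l r K)
  finally show ?thesis .
qed

section \<open>Waterman sequences and nonoverlapping families\<close>

lemma Waterman_sequence_pos: "Waterman_sequence L \<Longrightarrow> 1 \<le> j \<Longrightarrow> 0 < L j"
  by (simp add: Waterman_sequence_def)

lemma Waterman_sequence_antimono_inverse:
  assumes "Waterman_sequence L"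
  shows "antimono_on {1..} (\<lambda>j. 1 / L j)"
  using assms unfolding Waterman_sequence_def
  by (auto intro!: monotone_onI divide_left_mono elim!: monotone_onD)

lemma recip_sum_pos:
  assumes "Waterman_sequence L" "1 \<le> n"
  shows "0 < recip_sum L n"
  unfolding recip_sum_def using assms by (intro sum_pos) (auto simp: Waterman_sequence_def)

lemma sum_inverse_le_recip_sum:
  assumes "Waterman_sequence L" "finite A" "A \<subseteq> {1..}" "card A \<le> n"
  shows "(\<Sum>j\<in>A. 1 / L j) \<le> recip_sum L n"
  unfolding recip_sum_def
  using assms Waterman_sequence_pos[OF assms(1)]
  by (intro sum_le_sum_initial_segment[OF Waterman_sequence_antimono_inverse]) (auto intro: less_imp_le)

lemma nonoverlapping_intervals_permute:
  assumes "nonoverlapping_intervals s I" "bij_betw \<pi> {1..s} {1..s}"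
  shows "nonoverlapping_intervals s (I \<circ> \<pi>)"
proof -
  have "\<pi> i \<in> {1..s}" if "i \<in> {1..s}" for i
    using bij_betwE[OF assms(2)] that by blast
  moreover have "\<pi> i \<noteq> \<pi> j" if "i \<in> {1..s}" "j \<in> {1..s}" "i \<noteq> j" for i j
    using bij_betw_imp_inj_on[OF assms(2)] that by (meson inj_onD)
  ultimately show ?thesis
    using assms(1) unfolding nonoverlapping_intervals_def comp_def by blast
qed

lemma open_interval_subset_interior:
  fixes I :: "real set"
  assumes I: "is_interval I" "I \<noteq> {}" "I \<subseteq> {0..1}"
  shows "{Inf I<..<Sup I} \<subseteq> interior I"
proof (rule interior_maximal)
  have bdd: "bdd_above I" "bdd_below I"
    using I(3) by (auto intro: bdd_above_mono bdd_below_mono)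
  show "{Inf I<..<Sup I} \<subseteq> I"
  proof
    fix x assume "x \<in> {Inf I<..<Sup I}"
    then obtain y z where "y \<in> I" "y < x" "z \<in> I" "x < z"
      using bdd I(2) by (auto simp: cInf_less_iff less_cSup_iff)
    then show "x \<in> I"
      using I(1) unfolding is_interval_1 by (meson less_imp_le)
  qed
qed simp

text \<open>
  Two nondegenerate intervals with a common right endpoint both contain the points just below it in
  their interiors, and likewise on the left. A degenerate interval may share its point with others.
\<close>

lemma nonoverlapping_intervals_endpoints_inj:
  assumes "nonoverlapping_intervals s I"
  defines "J \<equiv> {j \<in> {1..s}. Inf (I j) \<noteq> Sup (I j)}"
  shows "inj_on (\<lambda>j. Sup (I j)) J" "inj_on (\<lambda>j. Inf (I j)) J"
proof -
  have less: "Inf (I j) < Sup (I j)" if "j \<in> J" for j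
  proof -
    have "I j \<noteq> {}" "I j \<subseteq> {0..1}" "Inf (I j) \<noteq> Sup (I j)"
      using that assms by (auto simp: nonoverlapping_intervals_def)
    moreover have "Inf (I j) \<le> Sup (I j)"
      using calculation by (intro cInf_le_cSup) (auto intro: bdd_above_mono bdd_below_mono)
    ultimately show ?thesis by simp
  qed
  have disj: "{Inf (I i)<..<Sup (I i)} \<inter> {Inf (I j)<..<Sup (I j)} = {}"
    if "i \<in> J" "j \<in> J" "i \<noteq> j" for i j
  proof -
    have ij: "i \<in> {1..s}" "j \<in> {1..s}" using that by (auto simp: J_def)
    then have "interior (I i) \<inter> interior (I j) = {}"
      using assms(1) \<open>i \<noteq> j\<close> unfolding nonoverlapping_intervals_def by blast
    moreover have "{Inf (I k)<..<Sup (I k)} \<subseteq> interior (I k)" if "k \<in> {1..s}" for k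
      using that assms(1) unfolding nonoverlapping_intervals_def
      by (intro open_interval_subset_interior) blast+
    ultimately show ?thesis using ij by blast
  qed
  show "inj_on (\<lambda>j. Sup (I j)) J"
  proof (rule inj_onI, rule ccontr)
    fix i j assume ij: "i \<in> J" "j \<in> J" "Sup (I i) = Sup (I j)" "i \<noteq> j"
    have "max (Inf (I i)) (Inf (I j)) < Sup (I i)" using less ij by (metis max_less_iff_conj)
    then obtain t where "max (Inf (I i)) (Inf (I j)) < t" "t < Sup (I i)" using dense by blast
    then have "t \<in> {Inf (I i)<..<Sup (I i)} \<inter> {Inf (I j)<..<Sup (I j)}" using ij by auto
    with disj ij show False by blast
  qed
  show "inj_on (\<lambda>j. Inf (I j)) J"
  proof (rule inj_onI, rule ccontr)
    fix i j assume ij: "i \<in> J" "j \<in> J" "Inf (I i) = Inf (I j)" "i \<noteq> j"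
    have "Inf (I i) < min (Sup (I i)) (Sup (I j))" using less ij by (metis min_less_iff_conj)
    then obtain t where "Inf (I i) < t" "t < min (Sup (I i)) (Sup (I j))" using dense by blast
    then have "t \<in> {Inf (I i)<..<Sup (I i)} \<inter> {Inf (I j)<..<Sup (I j)}" using ij by auto
    with disj ij show False by blast
  qed
qed

section \<open>Sufficiency\<close>

lemma Waterman_Shiba_subset:
  fixes p q C :: real
  assumes L: "Waterman_sequence L" and G: "Waterman_sequence G" and pq: "1 \<le> p" "p \<le> q"
    and le: "\<And>n. 1 \<le> n \<Longrightarrow> recip_sum G n powr (1 / q) / recip_sum L n powr (1 / p) \<le> C"
  shows "Waterman_Shiba L p \<subseteq> Waterman_Shiba G q"
proof
  fix f assume "f \<in> Waterman_Shiba L p"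
  then obtain M where M: "(\<Sum>j=1..s. \<bar>increment f (I j)\<bar> powr p / L j) \<le> M"
    if "nonoverlapping_intervals s I" for s I
    unfolding Waterman_Shiba_def bdd_above_def by blast
  define r where "r = q / p"
  have r: "1 \<le> r" and q: "0 < q" using pq by (auto simp: r_def)
  have GL: "recip_sum G n \<le> C powr q * recip_sum L n powr r" if "1 \<le> n" for n
  proof -
    have pos: "0 < recip_sum G n" "0 < recip_sum L n" using that L G recip_sum_pos by auto
    then have "recip_sum G n powr (1 / q) \<le> C * recip_sum L n powr (1 / p)"
      using le[OF that] by (simp add: field_simps)
    then have "(recip_sum G n powr (1 / q)) powr q \<le> (C * recip_sum L n powr (1 / p)) powr q"
      using q by (intro powr_mono2) auto
    also have "0 \<le> C"
      using le[OF that] by (meson divide_nonneg_nonneg order_trans powr_ge_zero)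
    then have "(C * recip_sum L n powr (1 / p)) powr q = C powr q * recip_sum L n powr r"
      by (simp add: powr_mult powr_powr r_def)
    finally show ?thesis using pos q by (simp add: powr_powr)
  qed
  have "(\<Sum>j=1..s. \<bar>increment f (I j)\<bar> powr q / G j) \<le> C powr q * M powr r"
    if I: "nonoverlapping_intervals s I" for s I
  proof -
    define a where "a j = \<bar>increment f (I j)\<bar>" for j
    obtain \<pi> where bij: "bij_betw \<pi> {1..s} {1..s}" and anti: "antimono_on {1..s} (a \<circ> \<pi>)"
      using exists_decreasing_enumeration by blast
    have a: "0 \<le> a j" for j by (simp add: a_def)
    have powr_anti: "antimono_on {1..s} (\<lambda>j. a (\<pi> j) powr t)" if "0 \<le> t" for t
      using monotone_onD[OF anti] a that by (auto intro!: monotone_onI powr_mono2)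
    have "(\<Sum>j=1..s. 1 / G j * a j powr q) \<le> (\<Sum>j=1..s. 1 / G j * a (\<pi> j) powr q)"
    proof (rule sum_mult_le_sum_mult_decreasing_rearrangement[OF _ _ _ bij])
      show "antimono_on {1..s} (\<lambda>j. 1 / G j)"
        by (rule monotone_on_subset[OF Waterman_sequence_antimono_inverse[OF G]]) auto
      show "antimono_on {1..s} ((\<lambda>j. a j powr q) \<circ> \<pi>)"
        using powr_anti[of q] q by (simp add: comp_def)
    qed (use Waterman_sequence_pos[OF G] in \<open>auto intro: less_imp_le\<close>)
    also have "\<dots> = (\<Sum>j=1..s. (a (\<pi> j) powr p) powr r * (1 / G j))"
      using pq by (simp add: powr_powr r_def mult.commute)
    also have "\<dots> \<le> C powr q * (\<Sum>j=1..s. a (\<pi> j) powr p * (1 / L j)) powr r"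
      using GL pq r Waterman_sequence_pos[OF L]
      by (intro sum_powr_weighted_le powr_anti) (auto simp: recip_sum_def intro: less_imp_le)
    also have "\<dots> \<le> C powr q * M powr r"
    proof (intro mult_left_mono powr_mono2)
      show "(\<Sum>j=1..s. a (\<pi> j) powr p * (1 / L j)) \<le> M"
        using M[OF nonoverlapping_intervals_permute[OF I bij]] by (simp add: a_def)
      show "0 \<le> (\<Sum>j=1..s. a (\<pi> j) powr p * (1 / L j))"
        using Waterman_sequence_pos[OF L] by (intro sum_nonneg) (auto intro!: divide_nonneg_pos)
    qed (use r in auto)
    finally show ?thesis by (simp add: a_def)
  qed
  then show "f \<in> Waterman_Shiba G q"
    unfolding Waterman_Shiba_def bdd_above_def by blast
qed

section \<open>Functions vanishing off a countable set\<close>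

text \<open>
  Injectivity of \<open>e\<close> bounds the number of indices \<open>j\<close> that hit \<open>X k\<close> by \<open>n k\<close>; they contribute most
  when they are the first \<open>n k\<close> indices.
\<close>

lemma sum_powr_at_distinct_points_le:
  fixes f e :: "_ \<Rightarrow> real" and h :: "nat \<Rightarrow> real"
  assumes L: "Waterman_sequence L" and J: "finite J" "J \<subseteq> {1..}" and e: "inj_on e J"
    and X: "\<And>k. finite (X k)" "\<And>k. card (X k) \<le> n k"
    and h: "\<And>k. h k powr p * recip_sum L (n k) \<le> (1/2) ^ k"
    and f: "\<And>x. f x \<noteq> 0 \<Longrightarrow> \<exists>k. x \<in> X k \<and> f x = h k"
  shows "(\<Sum>j\<in>J. f (e j) powr p / L j) \<le> 2"
proof -
  define J' where "J' = {j \<in> J. f (e j) \<noteq> 0}"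
  have J': "finite J'" "J' \<subseteq> J" using J by (auto simp: J'_def)
  have "\<forall>j\<in>J'. \<exists>k. e j \<in> X k \<and> f (e j) = h k" using f by (auto simp: J'_def)
  then obtain \<kappa> where \<kappa>: "e j \<in> X (\<kappa> j)" "f (e j) = h (\<kappa> j)" if "j \<in> J'" for j by metis
  have "(\<Sum>j\<in>J. f (e j) powr p / L j) = (\<Sum>j\<in>J'. f (e j) powr p / L j)"
    using J by (intro sum.mono_neutral_right) (auto simp: J'_def)
  also have "\<dots> = (\<Sum>k\<in>\<kappa> ` J'. \<Sum>j | j \<in> J' \<and> \<kappa> j = k. f (e j) powr p / L j)"
    using J' by (intro sum.image_gen)
  also have "\<dots> \<le> (\<Sum>k\<in>\<kappa> ` J'. (1/2) ^ k)"
  proof (rule sum_mono)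
    fix k
    let ?A = "{j \<in> J'. \<kappa> j = k}"
    have "card ?A \<le> card (X k)"
      using X \<kappa> J' by (intro card_inj_on_le[of e]) (auto intro: inj_on_subset[OF e])
    then have "(\<Sum>j\<in>?A. 1 / L j) \<le> recip_sum L (n k)"
      using J J' X(2)[of k] by (intro sum_inverse_le_recip_sum[OF L]) auto
    moreover have "(\<Sum>j\<in>?A. f (e j) powr p / L j) = h k powr p * (\<Sum>j\<in>?A. 1 / L j)"
      unfolding sum_distrib_left using \<kappa> by (intro sum.cong) auto
    ultimately show "(\<Sum>j\<in>?A. f (e j) powr p / L j) \<le> (1/2) ^ k"
      using h[of k] by (smt (verit) mult_left_mono powr_ge_zero)
  qed
  also have "\<dots> \<le> (\<Sum>k. (1/2) ^ k)"
    using J' by (intro sum_le_suminf) (auto intro: summable_geometric)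
  also have "\<dots> = 2" by (subst suminf_geometric) auto
  finally show ?thesis .
qed

text \<open>
  A nonnegative \<open>f\<close> satisfies \<open>\<bar>f v - f u\<bar>\<^sup>p \<le> (f v)\<^sup>p + (f u)\<^sup>p\<close>, so right and left endpoints can
  be estimated separately.
\<close>

lemma mem_Waterman_Shiba_if_countable_support:
  fixes f :: "real \<Rightarrow> real" and h :: "nat \<Rightarrow> real"
  assumes L: "Waterman_sequence L" and p: "0 \<le> p" and nonneg: "\<And>x. 0 \<le> f x"
    and X: "\<And>k. finite (X k)" "\<And>k. card (X k) \<le> n k"
    and h: "\<And>k. h k powr p * recip_sum L (n k) \<le> (1/2) ^ k"
    and f: "\<And>x. f x \<noteq> 0 \<Longrightarrow> \<exists>k. x \<in> X k \<and> f x = h k"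
  shows "f \<in> Waterman_Shiba L p"
proof -
  have "(\<Sum>j=1..s. \<bar>increment f (I j)\<bar> powr p / L j) \<le> 4"
    if I: "nonoverlapping_intervals s I" for s I
  proof -
    define J where "J = {j \<in> {1..s}. Inf (I j) \<noteq> Sup (I j)}"
    have J: "finite J" "J \<subseteq> {1..}" by (auto simp: J_def)
    have "(\<Sum>j=1..s. \<bar>increment f (I j)\<bar> powr p / L j)
        = (\<Sum>j\<in>J. \<bar>increment f (I j)\<bar> powr p / L j)"
      by (intro sum.mono_neutral_right) (auto simp: J_def increment_def)
    also have "\<dots> \<le> (\<Sum>j\<in>J. f (Sup (I j)) powr p / L j + f (Inf (I j)) powr p / L j)"
    proof (rule sum_mono)
      fix j assume "j \<in> J"
      then have "0 < L j" using J Waterman_sequence_pos[OF L] by auto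
      have bd: "\<bar>v - u\<bar> powr p \<le> v powr p + u powr p" if "0 \<le> u" "0 \<le> v" for u v :: real
      proof -
        have "\<bar>v - u\<bar> powr p \<le> max v u powr p"
          using that p by (intro powr_mono2) auto
        also have "\<dots> \<le> v powr p + u powr p" by (simp add: max_def)
        finally show ?thesis .
      qed
      show "\<bar>increment f (I j)\<bar> powr p / L j
          \<le> f (Sup (I j)) powr p / L j + f (Inf (I j)) powr p / L j"
        using bd[OF nonneg nonneg] \<open>0 < L j\<close>
        by (simp add: increment_def divide_right_mono flip: add_divide_distrib)
    qed
    also have "\<dots> \<le> 2 + 2"
      unfolding sum.distrib using nonoverlapping_intervals_endpoints_inj[OF I]
      by (intro add_mono sum_powr_at_distinct_points_le[OF L J _ X h f]) (auto simp: J_def)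
    finally show ?thesis by simp
  qed
  then show ?thesis unfolding Waterman_Shiba_def bdd_above_def by blast
qed

section \<open>Necessity\<close>

text \<open>
  The even denominators leave gaps: between two consecutive points \<open>tooth m\<close> lies the point \<open>1/(2m+3)\<close>, at which a comb vanishes.
\<close>

definition tooth :: "nat \<Rightarrow> real" where
  "tooth m = 1 / real (2 * m + 2)"

definition comb :: "(nat \<Rightarrow> real) \<Rightarrow> real \<Rightarrow> real" where
  "comb a x = (if x \<in> range tooth then a (inv tooth x) else 0)"

text \<open>
  Via the pairing function the values \<open>h k\<close> are distributed over the natural numbers so that \<open>h k\<close>
  occurs exactly \<open>n k\<close> times.
\<close>

definition repeated_values :: "(nat \<Rightarrow> nat) \<Rightarrow> (nat \<Rightarrow> real) \<Rightarrow> nat \<Rightarrow> real" where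
  "repeated_values n h m = (case prod_decode m of (k, i) \<Rightarrow> if i < n k then h k else 0)"

lemma inj_tooth: "inj tooth"
  by (auto simp: inj_def tooth_def field_simps)

lemma comb_tooth [simp]: "comb a (tooth m) = a m"
  by (simp add: comb_def inv_f_f[OF inj_tooth])

lemma comb_between_teeth [simp]: "comb a (1 / real (2 * m + 3)) = 0"
proof -
  have "1 / real (2 * m + 3) \<noteq> tooth i" for i
  proof
    assume "1 / real (2 * m + 3) = tooth i"
    then have "real (2 * m + 3) = real (2 * i + 2)"
      unfolding tooth_def by (simp add: field_simps)
    then have "2 * m + 3 = 2 * i + 2" by linarith
    then show False by presburger
  qed
  then show ?thesis by (auto simp: comb_def)
qed

lemma comb_nonzeroD:
  assumes "comb (repeated_values n h) x \<noteq> 0"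
  shows "\<exists>k. x \<in> (\<lambda>i. tooth (prod_encode (k, i))) ` {..<n k} \<and> comb (repeated_values n h) x = h k"
proof -
  obtain m where m: "x = tooth m" using assms by (auto simp: comb_def split: if_splits)
  obtain k i where ki: "prod_decode m = (k, i)" by fastforce
  then have "m = prod_encode (k, i)" by (metis prod_decode_inverse)
  with m ki assms show ?thesis
    by (intro exI[of _ k]) (auto simp: repeated_values_def split: if_splits)
qed

lemma nonoverlapping_teeth_intervals:
  assumes "inj_on \<mu> {1..s}"
  shows "nonoverlapping_intervals s (\<lambda>j. {1 / real (2 * \<mu> j + 3)..tooth (\<mu> j)})"
proof -
  have ordered: "tooth m' \<le> 1 / real (2 * m + 3)" if "m < m'" for m m'
    unfolding tooth_def using that by (intro divide_left_mono) auto
  have disj: "interior {1 / real (2 * m + 3)..tooth m} \<inter>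
      interior {1 / real (2 * m' + 3)..tooth m'} = {}"
    if "m \<noteq> m'" for m m'
  proof (cases "m < m'")
    case True
    then show ?thesis using ordered[of m m'] unfolding interior_atLeastAtMost_real by force
  next
    case False
    then have "m' < m" using that by simp
    then show ?thesis using ordered[of m' m] unfolding interior_atLeastAtMost_real by force
  qed
  have bounds: "0 \<le> 1 / real (2 * m + 3)" "1 / real (2 * m + 3) \<le> tooth m" "tooth m \<le> 1" for m
    by (auto simp: tooth_def field_simps)
  show ?thesis
    unfolding nonoverlapping_intervals_def
  proof (intro conjI ballI impI)
    fix i j assume "i \<in> {1..s}" "j \<in> {1..s}" "i \<noteq> j"
    then show "interior {1 / real (2 * \<mu> i + 3)..tooth (\<mu> i)} \<inter>
        interior {1 / real (2 * \<mu> j + 3)..tooth (\<mu> j)} = {}"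
      using assms by (intro disj) (meson inj_onD)
  next
    fix j
    show "{1 / real (2 * \<mu> j + 3)..tooth (\<mu> j)} \<noteq> {}" using bounds(2) by simp
    show "{1 / real (2 * \<mu> j + 3)..tooth (\<mu> j)} \<subseteq> {0..1}"
      using bounds(1,3) by (meson atLeastatMost_subset_iff)
  qed (rule is_interval_cc)
qed

lemma sum_increments_comb:
  "\<exists>I. nonoverlapping_intervals (n k) I \<and>
     (\<Sum>j=1..n k. \<bar>increment (comb (repeated_values n h)) (I j)\<bar> powr q / G j)
       = \<bar>h k\<bar> powr q * recip_sum G (n k)"
proof -
  define \<mu> where "\<mu> j = prod_encode (k, j - 1)" for j
  define I where "I j = {1 / real (2 * \<mu> j + 3)..tooth (\<mu> j)}" for j
  have "inj_on \<mu> {1..n k}" by (auto simp: inj_on_def \<mu>_def)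
  then have "nonoverlapping_intervals (n k) I"
    unfolding I_def by (rule nonoverlapping_teeth_intervals)
  moreover have "increment (comb (repeated_values n h)) (I j) = h k" if "j \<in> {1..n k}" for j
  proof -
    have le: "1 / real (2 * \<mu> j + 3) \<le> tooth (\<mu> j)" by (simp add: tooth_def field_simps)
    have "j - 1 < n k" using that by auto
    then have "repeated_values n h (\<mu> j) = h k"
      by (simp add: repeated_values_def \<mu>_def)
    moreover have "Sup (I j) = tooth (\<mu> j)" "Inf (I j) = 1 / real (2 * \<mu> j + 3)"
      using le by (simp_all only: I_def cSup_atLeastAtMost cInf_atLeastAtMost)
    ultimately show ?thesis by (simp only: increment_def comb_tooth comb_between_teeth)
  qed
  then have "(\<Sum>j=1..n k. \<bar>increment (comb (repeated_values n h)) (I j)\<bar> powr q / G j)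
       = \<bar>h k\<bar> powr q * recip_sum G (n k)"
    unfolding recip_sum_def sum_distrib_left by (intro sum.cong) auto
  ultimately show ?thesis by blast
qed

text \<open>
  The threshold \<open>4\<^sup>k\<close> has room for the factor \<open>2\<^sup>-\<^sup>k\<^sup>/\<^sup>p\<close> in \<open>h k\<close>, which is at least \<open>2\<^sup>-\<^sup>k\<close>
  because \<open>p \<ge> 1\<close>: the product still exceeds \<open>2\<^sup>k\<close>.
\<close>

lemma exists_mem_diff_Waterman_Shiba:
  fixes p q :: real
  assumes L: "Waterman_sequence L" and G: "Waterman_sequence G" and pq: "1 \<le> p" "1 \<le> q"
    and unbdd: "\<not> bdd_above
      ((\<lambda>n. recip_sum G n powr (1 / q) / recip_sum L n powr (1 / p)) ` {1..})"
  shows "\<exists>f. f \<in> Waterman_Shiba L p \<and> f \<notin> Waterman_Shiba G q"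
proof -
  have "\<exists>n\<ge>1. 4 ^ k < recip_sum G n powr (1 / q) / recip_sum L n powr (1 / p)" for k :: nat
    using unbdd by (fastforce simp: bdd_above_def not_le)
  then obtain n where n: "1 \<le> n k"
      "4 ^ k < recip_sum G (n k) powr (1 / q) / recip_sum L (n k) powr (1 / p)" for k :: nat
    by metis
  have pos: "0 < recip_sum L (n k)" "0 < recip_sum G (n k)" for k
    using L G n(1) recip_sum_pos by auto
  define h where "h k = ((1/2) ^ k / recip_sum L (n k)) powr (1 / p)" for k :: nat
  define f where "f = comb (repeated_values n h)"
  have h_nonneg: "0 \<le> h k" for k by (simp add: h_def)
  have "f \<in> Waterman_Shiba L p"
  proof (rule mem_Waterman_Shiba_if_countable_support[OF L])
    show "h k powr p * recip_sum L (n k) \<le> (1/2) ^ k" for k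
      using pos[of k] pq by (simp add: h_def powr_powr)
    show "\<exists>k. x \<in> (\<lambda>i. tooth (prod_encode (k, i))) ` {..<n k} \<and> f x = h k" if "f x \<noteq> 0" for x
      using comb_nonzeroD that unfolding f_def by blast
    show "0 \<le> f x" for x
      using h_nonneg by (auto simp: f_def comb_def repeated_values_def split: prod.split)
    show "card ((\<lambda>i. tooth (prod_encode (k, i))) ` {..<n k}) \<le> n k" for k
      using card_image_le[of "{..<n k}"] by simp
  qed (use pq in auto)
  moreover have "f \<notin> Waterman_Shiba G q"
  proof
    assume "f \<in> Waterman_Shiba G q"
    then obtain M where M: "(\<Sum>j=1..s. \<bar>increment f (I j)\<bar> powr q / G j) \<le> M"
      if "nonoverlapping_intervals s I" for s I
      unfolding Waterman_Shiba_def bdd_above_def by blast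
    have "2 ^ k \<le> M" for k :: nat
    proof -
      have "(2::real) ^ k = (1/2) ^ k * 4 ^ k"
        by (simp flip: power_mult_distrib)
      also have "\<dots> \<le> ((1/2) ^ k) powr (1 / p) * 4 ^ k"
      proof -
        have "((1/2::real) ^ k) powr 1 \<le> ((1/2) ^ k) powr (1 / p)"
          using pq by (intro powr_mono') (auto simp: power_le_one)
        then show ?thesis by simp
      qed
      also have "\<dots> \<le> ((1/2) ^ k) powr (1 / p) *
          (recip_sum G (n k) powr (1 / q) / recip_sum L (n k) powr (1 / p))"
        using n(2)[of k] by (intro mult_left_mono) auto
      also have "\<dots> = h k * recip_sum G (n k) powr (1 / q)"
        using pos[of k] by (simp add: h_def powr_divide)
      finally have "(2 ^ k) powr q \<le> (h k * recip_sum G (n k) powr (1 / q)) powr q"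
        using pq by (intro powr_mono2) auto
      also have "\<dots> = \<bar>h k\<bar> powr q * recip_sum G (n k)"
        using pos[of k] pq h_nonneg[of k] by (simp add: powr_mult powr_powr)
      also have "\<dots> \<le> M"
        using sum_increments_comb[of n k h q G] M unfolding f_def by metis
      finally have "(2 ^ k) powr q \<le> M" .
      moreover have "(2 ^ k :: real) powr 1 \<le> (2 ^ k) powr q"
        using pq by (intro powr_mono) auto
      ultimately show ?thesis by simp
    qed
    moreover obtain k where "M < 2 ^ k" using real_arch_pow[of 2 M] by auto
    ultimately show False by (meson not_le)
  qed
  ultimately show ?thesis by blast
qed

theorem corollary1p5:
  fixes \<Lambda> \<Gamma> :: "nat \<Rightarrow> real" and p q :: real
  assumes "Waterman_sequence \<Lambda>" and "Waterman_sequence \<Gamma>"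
    and "1 \<le> p" and "p \<le> q"
  shows "Waterman_Shiba \<Lambda> p \<subseteq> Waterman_Shiba \<Gamma> q \<longleftrightarrow>
    bdd_above ((\<lambda>n. recip_sum \<Gamma> n powr (1 / q) / recip_sum \<Lambda> n powr (1 / p)) ` {1..})"
proof
  assume "Waterman_Shiba \<Lambda> p \<subseteq> Waterman_Shiba \<Gamma> q"
  then show "bdd_above ((\<lambda>n. recip_sum \<Gamma> n powr (1 / q) / recip_sum \<Lambda> n powr (1 / p)) ` {1..})"
    using exists_mem_diff_Waterman_Shiba[OF assms(1-3)] assms(3,4)
    by (meson order_trans subsetD)
next
  assume "bdd_above ((\<lambda>n. recip_sum \<Gamma> n powr (1 / q) / recip_sum \<Lambda> n powr (1 / p)) ` {1..})"
  then obtain C where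
    "\<And>n. 1 \<le> n \<Longrightarrow> recip_sum \<Gamma> n powr (1 / q) / recip_sum \<Lambda> n powr (1 / p) \<le> C"
    by (auto simp: bdd_above_def)
  with assms show "Waterman_Shiba \<Lambda> p \<subseteq> Waterman_Shiba \<Gamma> q"
    by (rule Waterman_Shiba_subset)
qed

end
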